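(* $3 \leq \mathrm{Toep}_3 \leq 4$.
   Context: A matrix $T \in \mathbb{C}^{n\times n}$ is called Toeplitz if $T_{i,j} = T_{i+1,j+1}$ for all $i,j \in \{1,\dots,n-1\}$. For $M \in \mathbb{C}^{n\times n}$, the Toeplitz number $\mathrm{Toep}(M)$ is the minimal integer $s \geq 1$ such that $M = T_1 T_2 \cdots T_s$ for some Toeplitz matrices $T_1, \dots, T_s \in \mathbb{C}^{n\times n}$ (to be read as $\infty$ if no such $s$ exists). The maximal Toeplitz number of order $n$, denoted $\mathrm{Toep}_n$, is the maximum of $\mathrm{Toep}(M)$ over all $M \in \mathbb{C}^{n\times n}$. *)

theory Defs
  imports Complex_Main "HOL-Library.Extended_Nat" "Jordan_Normal_Form.Matrix"
begin

definition toeplitz_mat :: "nat \<Rightarrow> complex mat \<Rightarrow> bool" where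
  "toeplitz_mat n T \<longleftrightarrow> T \<in> carrier_mat n n \<and>
     (\<forall>i j. Suc i < n \<longrightarrow> Suc j < n \<longrightarrow> T $$ (i, j) = T $$ (Suc i, Suc j))"

definition mat_list_prod :: "nat \<Rightarrow> complex mat list \<Rightarrow> complex mat" where
  "mat_list_prod n Ts = foldr (*) Ts (1\<^sub>m n)"

definition toeplitz_product :: "nat \<Rightarrow> nat \<Rightarrow> complex mat \<Rightarrow> bool" where
  "toeplitz_product n s M \<longleftrightarrow>
     (\<exists>Ts. length Ts = s \<and> (\<forall>T \<in> set Ts. toeplitz_mat n T) \<and> M = mat_list_prod n Ts)"

(* The infimum in enat is the least element, and \<infinity> on the empty set. *)
definition toeplitz_number :: "nat \<Rightarrow> complex mat \<Rightarrow> enat" where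
  "toeplitz_number n M = Inf {enat s | s. 1 \<le> s \<and> toeplitz_product n s M}"

(* The supremum in enat is the maximum of a finite nonempty set, and \<infinity> on an infinite set. *)
definition max_toeplitz_number :: "nat \<Rightarrow> enat" where
  "max_toeplitz_number n = (SUP M \<in> carrier_mat n n. toeplitz_number n M)"

(* A finite value of the supremum is attained, so it is a genuine maximum. *)
lemma max_toeplitz_number_attained:
  assumes "max_toeplitz_number n = enat k"
  shows "\<exists>M \<in> carrier_mat n n. toeplitz_number n M = enat k"
proof -
  let ?A = "toeplitz_number n ` carrier_mat n n"
  have ne: "?A \<noteq> {}" using zero_carrier_mat by blast
  have fin: "finite ?A" and "Max ?A = enat k"
    using assms ne unfolding max_toeplitz_number_def Sup_enat_def
    by (simp_all split: if_splits)
  with Max_in[OF fin ne] show ?thesis by fastforce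
qed

end

theory Submission
  imports Defs "HOL-Computational_Algebra.Polynomial"
begin

text \<open>
  Lower bound. Transposing along the antidiagonal fixes every Toeplitz matrix and reverses products.
  So \<open>D = A * B\<close> with Toeplitz \<open>A\<close>, \<open>B\<close> forces \<open>B * A = D'\<close>, where \<open>D'\<close> is \<open>D\<close> transposed along
  the antidiagonal, and hence \<open>D * A = A * B * A = A * D'\<close>. For \<open>D = diag(1, 2, 3)\<close> this kills every
  entry of \<open>A\<close> off the antidiagonal; being Toeplitz, \<open>A\<close> then has a zero middle row, which the
  middle row of \<open>D\<close> does not allow (lemma \<open>diag_123_not_two_toeplitz\<close>).

  Upper bound, singular case. If a nonzero row vector annihilates \<open>M\<close>, then the plane it annihilates
  is spanned by the first and third column of some Toeplitz matrix \<open>T\<close>, because these two columns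
  share only one entry. So \<open>M = T * N\<close> where the middle row of \<open>N\<close> is zero. With \<open>E\<close> the
  Toeplitz matrix that has ones in the two antidiagonal corners and zeros elsewhere, \<open>E * K\<close> has a
  zero middle row whatever the middle row of \<open>K\<close> is, and \<open>K\<close> can be chosen as a product of two
  Toeplitz matrices since its first and third row may be prescribed freely
  (lemma \<open>outer_rows_completion\<close>). This gives \<open>M = T * E * A * B\<close>.

  Upper bound, nonsingular case. A matrix \<open>K\<close> whose first column is a nonzero multiple of the second
  unit vector \<open>e2\<close> is a product of three Toeplitz matrices as soon as two quadratic expressions in its
  entries do not vanish (lemma \<open>three_toeplitz_if_first_column_e2\<close>). Given \<open>M\<close>, one looks for a matrix
  \<open>X\<close> with a Toeplitz inverse such that \<open>K = M * X\<close> has this shape; then \<open>M = K * inverse X\<close> is a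
  product of four. The first column of \<open>X\<close> has to be a multiple of the preimage \<open>x\<close> of \<open>e2\<close> under \<open>M\<close>.
  If the first coordinate of \<open>x\<close> is nonzero and \<open>x\<close> is not on the first axis, then a two-parameter
  family of such \<open>X\<close> remains, and the nonvanishing conditions are nonzero polynomials in the two
  parameters (lemma \<open>four_toeplitz_if_preimage_not_axis\<close>). If \<open>x\<close> is on the first axis then \<open>X\<close> can
  be the identity, and when \<open>M\<close> violates one of the conditions an explicit factorization exists (lemma
  \<open>four_toeplitz_if_first_column_e2\<close>). Reversing the order of rows and columns turns a nonzero
  third coordinate of \<open>x\<close> into a nonzero first one, and \<open>x\<close> on the second axis is treated
  directly (lemma \<open>four_toeplitz_if_second_column_e2\<close>).
\<close>

section \<open>Matrices of order three given by their entries\<close>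

definition m3 :: "complex \<Rightarrow> complex \<Rightarrow> complex \<Rightarrow> complex \<Rightarrow> complex \<Rightarrow> complex \<Rightarrow> complex \<Rightarrow> complex \<Rightarrow> complex \<Rightarrow> complex mat"
  where "m3 a b c d e f g h k = mat 3 3 (\<lambda>(i,j). [[a,b,c],[d,e,f],[g,h,k]] ! i ! j)"

text \<open>
  The arguments run along the diagonals from the lower left corner to the upper right corner.
\<close>

abbreviation toep :: "complex \<Rightarrow> complex \<Rightarrow> complex \<Rightarrow> complex \<Rightarrow> complex \<Rightarrow> complex mat"
  where "toep t2 t1 t0 u1 u2 \<equiv> m3 t0 u1 u2 t1 t0 u1 t2 t1 t0"

lemma less_three_cases: "i < 3 \<Longrightarrow> i = 0 \<or> i = 1 \<or> i = (2::nat)"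
  by auto

lemma m3_carrier [simp]: "m3 a b c d e f g h k \<in> carrier_mat 3 3"
  by (simp add: m3_def)

lemma m3_cases:
  assumes "M \<in> carrier_mat 3 3"
  obtains a b c d e f g h k where "M = m3 a b c d e f g h k"
proof
  show "M = m3 (M $$ (0,0)) (M $$ (0,1)) (M $$ (0,2)) (M $$ (1,0)) (M $$ (1,1)) (M $$ (1,2))
      (M $$ (2,0)) (M $$ (2,1)) (M $$ (2,2))"
    using assms by (intro eq_matI) (auto simp: m3_def dest!: less_three_cases)
qed

lemma m3_eq_iff:
  "m3 a b c d e f g h k = m3 a' b' c' d' e' f' g' h' k' \<longleftrightarrow>
     a = a' \<and> b = b' \<and> c = c' \<and> d = d' \<and> e = e' \<and> f = f' \<and> g = g' \<and> h = h' \<and> k = k'"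
    (is "?A = ?B \<longleftrightarrow> _")
proof
  assume eq: "?A = ?B"
  have "?A $$ (i, j) = ?B $$ (i, j)" for i j using eq by simp
  from this[of 0 0] this[of 0 1] this[of 0 2] this[of 1 0] this[of 1 1] this[of 1 2]
    this[of 2 0] this[of 2 1] this[of 2 2]
  show "a = a' \<and> b = b' \<and> c = c' \<and> d = d' \<and> e = e' \<and> f = f' \<and> g = g' \<and> h = h' \<and> k = k'"
    by (simp add: m3_def)
qed simp

lemma m3_mult:
  "m3 a b c d e f g h k * m3 a' b' c' d' e' f' g' h' k' =
   m3 (a*a'+b*d'+c*g') (a*b'+b*e'+c*h') (a*c'+b*f'+c*k')
      (d*a'+e*d'+f*g') (d*b'+e*e'+f*h') (d*c'+e*f'+f*k')
      (g*a'+h*d'+k*g') (g*b'+h*e'+k*h') (g*c'+h*f'+k*k')" (is "?A * ?B = ?C")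
proof (rule eq_matI)
  fix i j assume "i < dim_row ?C" "j < dim_col ?C"
  then have ij: "i < 3" "j < 3" by (simp_all add: m3_def)
  have "(?A * ?B) $$ (i, j) = (\<Sum>l = 0..<3. ?A $$ (i, l) * ?B $$ (l, j))"
    using ij by (simp add: m3_def scalar_prod_def)
  also have "\<dots> = ?A $$ (i, 0) * ?B $$ (0, j) + ?A $$ (i, 1) * ?B $$ (1, j) + ?A $$ (i, 2) * ?B $$ (2, j)"
    by (simp add: numeral_3_eq_3 numeral_2_eq_2)
  also have "\<dots> = ?C $$ (i, j)"
    using less_three_cases[OF ij(1)] less_three_cases[OF ij(2)]
    by (elim disjE) (simp_all add: m3_def)
  finally show "(?A * ?B) $$ (i, j) = ?C $$ (i, j)" .
qed (simp_all add: m3_def)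

lemma one_m3: "1\<^sub>m 3 = m3 1 0 0 0 1 0 0 0 1"
  by (rule eq_matI) (auto simp: m3_def dest!: less_three_cases)

lemma toeplitz_mat_m3_iff: "toeplitz_mat 3 (m3 a b c d e f g h k) \<longleftrightarrow> a = e \<and> b = f \<and> d = h \<and> e = k"
proof -
  have all: "(\<forall>i j. Suc i < 3 \<longrightarrow> Suc j < 3 \<longrightarrow> P i j) \<longleftrightarrow> P 0 0 \<and> P 0 1 \<and> P 1 0 \<and> P 1 1"
    for P :: "nat \<Rightarrow> nat \<Rightarrow> bool"
    by (auto simp: numeral_3_eq_3 less_Suc_eq)
  show ?thesis unfolding toeplitz_mat_def all by (auto simp: m3_def)
qed

lemma toeplitz_mat_toep: "toeplitz_mat 3 (toep t2 t1 t0 u1 u2)"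
  by (simp add: toeplitz_mat_m3_iff)

lemma toeplitz_mat_3_cases:
  assumes "toeplitz_mat 3 T"
  obtains t2 t1 t0 u1 u2 where "T = toep t2 t1 t0 u1 u2"
proof -
  have "T \<in> carrier_mat 3 3" using assms by (simp add: toeplitz_mat_def)
  then obtain a b c d e f g h k where "T = m3 a b c d e f g h k" by (rule m3_cases)
  then show thesis using assms that by (simp add: toeplitz_mat_m3_iff)
qed

section \<open>Products of Toeplitz matrices\<close>

lemma toeplitz_mat_one: "toeplitz_mat n (1\<^sub>m n)"
  by (auto simp: toeplitz_mat_def)

lemma mat_list_prod_carrier:
  "\<forall>T \<in> set Ts. T \<in> carrier_mat n n \<Longrightarrow> mat_list_prod n Ts \<in> carrier_mat n n"
  by (induction Ts) (auto simp: mat_list_prod_def)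

lemma mat_list_prod_append:
  "\<forall>T \<in> set Ts \<union> set Us. T \<in> carrier_mat n n \<Longrightarrow>
    mat_list_prod n (Ts @ Us) = mat_list_prod n Ts * mat_list_prod n Us"
proof (induction Ts)
  case Nil
  then show ?case using mat_list_prod_carrier[of Us n] by (simp add: mat_list_prod_def)
next
  case (Cons T Ts)
  then show ?case
    using mat_list_prod_carrier[of Ts n] mat_list_prod_carrier[of Us n]
    by (auto simp: mat_list_prod_def)
qed

lemma toeplitz_productI1: "toeplitz_mat n T \<Longrightarrow> toeplitz_product n 1 T"
  unfolding toeplitz_product_def
  by (intro exI[of _ "[T]"]) (auto simp: mat_list_prod_def toeplitz_mat_def)

lemma toeplitz_product_mult:
  assumes "toeplitz_product n s M" and "toeplitz_product n t N"
  shows "toeplitz_product n (s + t) (M * N)"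
proof -
  obtain Ts Us where Ts: "length Ts = s" "\<forall>T \<in> set Ts. toeplitz_mat n T" "M = mat_list_prod n Ts"
    and Us: "length Us = t" "\<forall>T \<in> set Us. toeplitz_mat n T" "N = mat_list_prod n Us"
    using assms unfolding toeplitz_product_def by blast
  have "mat_list_prod n (Ts @ Us) = M * N"
    unfolding Ts(3) Us(3) using Ts(2) Us(2)
    by (intro mat_list_prod_append) (auto simp: toeplitz_mat_def)
  then show ?thesis unfolding toeplitz_product_def using Ts(1,2) Us(1,2)
    by (intro exI[of _ "Ts @ Us"]) auto
qed

lemma toeplitz_product_carrier: "toeplitz_product n s M \<Longrightarrow> M \<in> carrier_mat n n"
  by (auto simp: toeplitz_product_def toeplitz_mat_def intro!: mat_list_prod_carrier)

text \<open>
  The identity is Toeplitz, so that a product can be padded with further factors.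
\<close>

lemma toeplitz_product_mono:
  assumes "toeplitz_product n s M" "s \<le> t"
  shows "toeplitz_product n t M"
proof -
  have "toeplitz_product n (s + k) M" for k
  proof (induction k)
    case (Suc k)
    from toeplitz_product_mult[OF Suc toeplitz_productI1[OF toeplitz_mat_one]]
    show ?case using toeplitz_product_carrier[OF assms(1)] by simp
  qed (simp add: assms(1))
  from this[of "t - s"] show ?thesis using assms(2) by simp
qed

lemma toeplitz_productI2:
  assumes "toeplitz_mat n A" "toeplitz_mat n B"
  shows "toeplitz_product n 2 (A * B)"
  using toeplitz_product_mult[OF assms[THEN toeplitz_productI1]] by (simp add: numeral_2_eq_2)

lemma toeplitz_productI3:
  assumes "toeplitz_mat n A" "toeplitz_mat n B" "toeplitz_mat n C"
  shows "toeplitz_product n 3 (A * B * C)"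
  using toeplitz_product_mult[OF toeplitz_productI2[OF assms(1,2)] toeplitz_productI1[OF assms(3)]]
  by simp

lemma toeplitz_productI4:
  assumes "toeplitz_mat n A" "toeplitz_mat n B" "toeplitz_mat n C" "toeplitz_mat n D"
  shows "toeplitz_product n 4 (A * B * C * D)"
  using toeplitz_product_mult[OF toeplitz_productI3[OF assms(1-3)] toeplitz_productI1[OF assms(4)]]
  by simp

lemma toeplitz_product_2E:
  assumes "toeplitz_product n 2 M"
  obtains A B where "toeplitz_mat n A" "toeplitz_mat n B" "M = A * B"
proof -
  obtain Ts where Ts: "length Ts = 2" "\<forall>T \<in> set Ts. toeplitz_mat n T" "M = mat_list_prod n Ts"
    using assms by (auto simp: toeplitz_product_def)
  then obtain A B where "Ts = [A, B]"
    by (auto simp: numeral_2_eq_2 length_Suc_conv)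
  with Ts show thesis by (intro that[of A B]) (auto simp: mat_list_prod_def toeplitz_mat_def)
qed

section \<open>A matrix that is not a product of two Toeplitz matrices\<close>

lemma diag_123_not_two_toeplitz: "\<not> toeplitz_product 3 2 (m3 1 0 0 0 2 0 0 0 3)"
proof
  let ?D = "m3 1 0 0 0 2 0 0 0 3" and ?D' = "m3 3 0 0 0 2 0 0 0 1"
  assume "toeplitz_product 3 2 ?D"
  then obtain A B where tA: "toeplitz_mat 3 A" and tB: "toeplitz_mat 3 B" and D: "?D = A * B"
    by (rule toeplitz_product_2E)
  obtain t2 t1 t0 u1 u2 where A: "A = toep t2 t1 t0 u1 u2" using tA by (rule toeplitz_mat_3_cases)
  obtain s2 s1 s0 v1 v2 where B: "B = toep s2 s1 s0 v1 v2" using tB by (rule toeplitz_mat_3_cases)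
  \<comment> \<open>As \<open>A\<close> and \<open>B\<close> are symmetric about the antidiagonal, the nine equations between entries in
    \<open>D = A * B\<close> are, up to order, those in \<open>B * A = D'\<close>.\<close>
  have D': "B * A = ?D'"
    using D unfolding A B m3_mult m3_eq_iff by (simp add: ac_simps)
  have "?D * A = A * (B * A)"
    unfolding D by (rule assoc_mult_mat[of _ 3 3 _ 3 _ 3]) (simp_all add: A B)
  then have "?D * A = A * ?D'" by (simp only: D')
  then have "t0 = 0 \<and> t1 = 0 \<and> u1 = 0"
    unfolding A m3_mult m3_eq_iff by simp
  then show False
    using D unfolding A B m3_mult m3_eq_iff by simp
qed

section \<open>Reversing the order of rows and columns\<close>

text \<open>
  Conjugation by the exchange matrix \<open>J\<close> is multiplicative, as \<open>J\<close> is an involution, and it maps a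
  Toeplitz matrix to its transpose.
\<close>

lemma toeplitz_product_reverse:
  assumes "toeplitz_product 3 s (m3 a b c d e f g h k)"
  shows "toeplitz_product 3 s (m3 k h g f e d c b a)"
proof -
  define J where "J = m3 0 0 1 0 1 0 1 0 0"
  have J: "J \<in> carrier_mat 3 3" by (simp add: J_def)
  have JJ: "J * J = 1\<^sub>m 3" by (simp add: J_def m3_mult one_m3)
  have conj_toeplitz: "toeplitz_mat 3 (J * T * J)" if "toeplitz_mat 3 T" for T
    using that by (elim toeplitz_mat_3_cases) (simp add: J_def m3_mult toeplitz_mat_m3_iff)
  have conj_mult: "J * (M * N) * J = (J * M * J) * (J * N * J)"
    if "M \<in> carrier_mat 3 3" "N \<in> carrier_mat 3 3" for M N
    using that by (elim m3_cases) (simp add: J_def m3_mult m3_eq_iff ac_simps)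
  have "J * mat_list_prod 3 Ts * J = mat_list_prod 3 (map (\<lambda>T. J * T * J) Ts)"
    if "\<forall>T \<in> set Ts. toeplitz_mat 3 T" for Ts
    using that
  proof (induction Ts)
    case Nil
    then show ?case using J JJ by (simp add: mat_list_prod_def)
  next
    case (Cons T Ts)
    then show ?case
      using conj_mult[of T "mat_list_prod 3 Ts"] mat_list_prod_carrier[of Ts 3]
      by (simp add: mat_list_prod_def toeplitz_mat_def)
  qed
  then have "toeplitz_product 3 s (J * m3 a b c d e f g h k * J)"
    using assms conj_toeplitz unfolding toeplitz_product_def
    by (metis (no_types, lifting) imageE length_map list.set_map)
  then show ?thesis by (simp add: J_def m3_mult)
qed

section \<open>Singular matrices\<close>

text \<open>
  Look for \<open>B\<close> as the inverse of a unipotent triangular Toeplitz matrix \<open>X\<close> with off-diagonal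
  entries \<open>p\<close>, \<open>q\<close>. Then the first and third row of \<open>A\<close> must be those of the prescribed matrix
  times \<open>X\<close>. Two outer rows extend to a Toeplitz matrix exactly if the first entry of the top row is
  the last entry of the bottom row. For \<open>X\<close> upper or lower triangular this is one linear
  equation in \<open>p\<close>, \<open>q\<close>. If neither equation is solvable then all prescribed entries except two
  corner entries are zero, and two factors supported on the antidiagonal corners produce these.
\<close>

lemma outer_rows_completion:
  obtains A B x y z where "toeplitz_mat 3 A" "toeplitz_mat 3 B" "A * B = m3 a1 a2 a3 x y z c1 c2 c3"
proof -
  consider p q where "a1 = c1 * q + c2 * p + c3"
    | p q where "c3 = a1 + p * a2 + q * a3"
    | "c1 = 0" "c2 = 0" "a2 = 0" "a3 = 0"
  proof -
    have "\<exists>p q. w = u * p + v * q" if "u \<noteq> 0 \<or> v \<noteq> 0" for u v w :: complex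
    proof (cases "u = 0")
      case True then show ?thesis using that by (intro exI[of _ 0] exI[of _ "w / v"]) simp
    next
      case False then show ?thesis by (intro exI[of _ "w / u"] exI[of _ 0]) simp
    qed
    from this[of c1 c2 "a1 - c3"] this[of a2 a3 "c3 - a1"] that
    show ?thesis by (metis add.assoc add.commute diff_add_cancel mult.commute)
  qed
  then show thesis
  proof cases
    case 1
    show thesis
      by (rule that[where x = "c2+p*c1" and y = "a1-p*(c2+p*c1)" and z = "a2+(p^2-q)*(c2+p*c1)",
            of "toep c1 (c2+p*c1) a1 (a2+p*a1) (a3+p*a2+q*a1)" "toep 0 0 1 (-p) (p^2-q)"])
        (simp_all add: toeplitz_mat_toep m3_mult m3_eq_iff 1 algebra_simps power2_eq_square)
  next
    case 2
    show thesis
      by (rule that[where x = "c2+(p^2-q)*(a2+p*a3)" and y = "c3-p*(a2+p*a3)" and z = "a2+p*a3",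
            of "toep (c1+p*c2+q*c3) (c2+p*c3) c3 (a2+p*a3) a3" "toep (p^2-q) (-p) 1 0 0"])
        (simp_all add: toeplitz_mat_toep m3_mult m3_eq_iff 2 algebra_simps power2_eq_square)
  next
    case 3
    show thesis
      by (rule that[where x = 0 and y = 0 and z = 0, of "toep 1 0 0 0 1" "toep a1 0 0 0 c3"])
        (simp_all add: toeplitz_mat_toep m3_mult m3_eq_iff 3)
  qed
qed

text \<open>
  The first and third column of a Toeplitz matrix are \<open>(t0, t1, t2)\<close> and \<open>(u2, u1, t0)\<close>. Each of them
  must be orthogonal to \<open>(p, q, r)\<close> and they must be independent. For \<open>q \<noteq> 0\<close> this is possible with
  \<open>t0 = 0\<close>. For \<open>q = 0\<close> the middle entries \<open>t1\<close>, \<open>u1\<close> are unconstrained, and setting one of them to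
  one and the other to zero makes the columns independent.
\<close>

lemma plane_spanned_by_toeplitz_columns:
  fixes p q r :: complex
  assumes "p \<noteq> 0 \<or> q \<noteq> 0 \<or> r \<noteq> 0"
  obtains t2 t1 t0 u1 u2 where
    "\<And>v1 v2 v3. p * v1 + q * v2 + r * v3 = 0 \<Longrightarrow>
       \<exists>k l. v1 = k * t0 + l * u2 \<and> v2 = k * t1 + l * u1 \<and> v3 = k * t2 + l * t0"
proof -
  consider "q \<noteq> 0" | "q = 0" "r \<noteq> 0" | "q = 0" "r = 0" "p \<noteq> 0" using assms by blast
  then show thesis
  proof cases
    case 1
    show thesis
    proof (rule that[where ?t0.0 = 0 and ?t1.0 = r and ?t2.0 = "-q" and ?u1.0 = "-p" and ?u2.0 = q])
      fix v1 v2 v3 assume "p * v1 + q * v2 + r * v3 = 0"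
      then have "q * v2 = - (p * v1) - r * v3" by (simp add: algebra_simps eq_neg_iff_add_eq_0)
      then have "v2 = (- v3 / q) * r + (v1 / q) * - p" using 1 by (simp add: field_simps)
      then show "\<exists>k l. v1 = k * 0 + l * q \<and> v2 = k * r + l * - p \<and> v3 = k * - q + l * 0"
        using 1 by (intro exI[of _ "- v3 / q"] exI[of _ "v1 / q"]) simp
    qed
  next
    case 2
    show thesis
    proof (rule that[where ?t0.0 = "p*r" and ?t1.0 = 1 and ?t2.0 = "-(p^2)" and ?u1.0 = 0 and ?u2.0 = "-(r^2)"])
      fix v1 v2 v3 assume "p * v1 + q * v2 + r * v3 = 0"
      then have v3: "v3 = - (p * v1) / r" using 2
        by (simp add: field_simps eq_neg_iff_add_eq_0)
      show "\<exists>k l. v1 = k * (p * r) + l * - (r^2) \<and> v2 = k * 1 + l * 0 \<and> v3 = k * - (p^2) + l * (p * r)"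
        using 2 unfolding v3
        by (intro exI[of _ v2] exI[of _ "(v2 * p * r - v1) / r^2"])
           (simp add: field_simps power2_eq_square)
    qed
  next
    case 3
    then show thesis
      by (intro that[where ?t0.0 = 0 and ?t1.0 = 0 and ?t2.0 = 1 and ?u1.0 = 1 and ?u2.0 = 0]) auto
  qed
qed

text \<open>
  The coordinates of the columns of the matrix in the basis given by the preceding lemma are the rows
  \<open>k\<close> and \<open>l\<close>. The second factor swaps the outer rows of what follows and deletes its middle row, hence
  \<open>l\<close> is prescribed as the first row and \<open>k\<close> as the third.
\<close>

lemma four_toeplitz_singular:
  assumes "p \<noteq> 0 \<or> q \<noteq> 0 \<or> r \<noteq> 0"
    and "p * a + q * d + r * g = 0" "p * b + q * e + r * h = 0" "p * c + q * f + r * k = 0"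
  shows "toeplitz_product 3 4 (m3 a b c d e f g h k)"
proof -
  obtain t2 t1 t0 u1 u2 where span: "\<And>v1 v2 v3. p * v1 + q * v2 + r * v3 = 0 \<Longrightarrow>
       \<exists>k l. v1 = k * t0 + l * u2 \<and> v2 = k * t1 + l * u1 \<and> v3 = k * t2 + l * t0"
    by (rule plane_spanned_by_toeplitz_columns[OF assms(1)]) blast
  obtain k1 l1 where 1: "a = k1 * t0 + l1 * u2" "d = k1 * t1 + l1 * u1" "g = k1 * t2 + l1 * t0"
    using span[OF assms(2)] by blast
  obtain k2 l2 where 2: "b = k2 * t0 + l2 * u2" "e = k2 * t1 + l2 * u1" "h = k2 * t2 + l2 * t0"
    using span[OF assms(3)] by blast
  obtain k3 l3 where 3: "c = k3 * t0 + l3 * u2" "f = k3 * t1 + l3 * u1" "k = k3 * t2 + l3 * t0"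
    using span[OF assms(4)] by blast
  obtain A B x y z where AB: "toeplitz_mat 3 A" "toeplitz_mat 3 B"
    "A * B = m3 l1 l2 l3 x y z k1 k2 k3"
    by (rule outer_rows_completion)
  have "toeplitz_product 3 (2 + 2) ((toep t2 t1 t0 u1 u2 * toep 1 0 0 0 1) * (A * B))"
    by (intro toeplitz_product_mult toeplitz_productI2 AB toeplitz_mat_toep)
  also have "(toep t2 t1 t0 u1 u2 * toep 1 0 0 0 1) * (A * B) = m3 a b c d e f g h k"
    unfolding AB(3) m3_mult m3_eq_iff using 1 2 3 by (simp add: algebra_simps)
  finally show ?thesis by simp
qed

text \<open>
  The cofactors of a column form a kernel vector. If all cofactors vanish, the rank is at most one;
  then the first two rows are proportional, and the entries of any column in these rows are the
  coefficients of a relation between them.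
\<close>

lemma left_kernel_of_singular:
  fixes a b c d e f g h k :: complex
  assumes "a * (e * k - f * h) - b * (d * k - f * g) + c * (d * h - e * g) = 0"
  obtains p q r where "p \<noteq> 0 \<or> q \<noteq> 0 \<or> r \<noteq> 0"
    "p * a + q * d + r * g = 0" "p * b + q * e + r * h = 0" "p * c + q * f + r * k = 0"
proof (cases "e * k = f * h \<and> c * h = b * k \<and> b * f = c * e \<and>
    f * g = d * k \<and> a * k = c * g \<and> c * d = a * f \<and>
    d * h = e * g \<and> b * g = a * h \<and> a * e = b * d")
  case True
  then show thesis
    using that[of d "-a" 0] that[of e "-b" 0] that[of f "-c" 0] that[of 1 0 0]
    by (cases "a = 0 \<and> b = 0 \<and> c = 0") (auto simp: algebra_simps)
next
  case False
  then show thesis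
    using that[of "e * k - f * h" "c * h - b * k" "b * f - c * e"]
      that[of "f * g - d * k" "a * k - c * g" "c * d - a * f"]
      that[of "d * h - e * g" "b * g - a * h" "a * e - b * d"] assms
    by (auto simp: algebra_simps)
qed

section \<open>Nonsingular matrices\<close>

text \<open>
  The factorization comes from the product of
  \<open>[[1, 0, s], [0, 1, 0], [r, 0, 1]]\<close>, \<open>[[0, x, y], [1, 0, x], [0, 1, 0]]\<close> and a unipotent upper
  triangular Toeplitz matrix with off-diagonal entries \<open>p\<close>, \<open>q\<close>. Its first column is \<open>e2\<close>, and
  comparing the other six entries with those of the given matrix divided by \<open>m\<close> gives six equations
  for the six parameters. They yield \<open>y = f1 / m^2\<close>, where \<open>f1\<close> and \<open>f3\<close> are the two expressions
  assumed nonzero, then \<open>r = f3 / f1\<close> by a division by \<open>y\<close>, and finally \<open>x\<close> by a division by \<open>r\<close>.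
\<close>

lemma three_toeplitz_if_first_column_e2:
  assumes "m \<noteq> 0" and F1: "m * k13 \<noteq> k22 * k12" and F3: "m * k33 \<noteq> k22 * k32"
  shows "toeplitz_product 3 3 (m3 0 k12 k13 m k22 k23 0 k32 k33)"
proof -
  define f1 f3 where "f1 = m * k13 - k22 * k12" and "f3 = m * k33 - k22 * k32"
  have nz: "f1 \<noteq> 0" "f3 \<noteq> 0" using F1 F3 by (simp_all add: f1_def f3_def)
  have k13: "k13 = (f1 + k22 * k12) / m" and k33: "k33 = (f3 + k22 * k32) / m"
    using assms(1) by (simp_all add: f1_def f3_def)
  define x where "x = (k32 - m) * f1 / (m * f3)"
  have "toeplitz_product 3 3 (toep (m * f3 / f1) 0 m 0 (k12 - m * x) * toep 0 1 0 x (f1 / m^2)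
      * toep 0 0 1 (k22 / m) (k23 / m - x))"
    by (intro toeplitz_productI3 toeplitz_mat_toep)
  also have "toep (m * f3 / f1) 0 m 0 (k12 - m * x) * toep 0 1 0 x (f1 / m^2)
      * toep 0 0 1 (k22 / m) (k23 / m - x) = m3 0 k12 k13 m k22 k23 0 k32 k33"
    unfolding m3_mult m3_eq_iff x_def k13 k33 using assms(1) nz
    by (simp add: field_simps power2_eq_square)
  finally show ?thesis .
qed


lemma bivariate_nonroot:
  fixes P :: "complex poly poly"
  assumes "P \<noteq> 0"
  obtains x y where "poly (poly P [:y:]) x \<noteq> 0"
proof -
  have "infinite (range (\<lambda>y::complex. [:y:]))"
    using infinite_UNIV_char_0[where 'a = complex] finite_imageD[of "\<lambda>y::complex. [:y:]" UNIV]
    by (meson inj_onI pCons_eq_iff)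
  then have "\<not> range (\<lambda>y::complex. [:y:]) \<subseteq> {q. poly P q = 0}"
    using poly_roots_finite[OF assms] finite_subset by blast
  then obtain y where y: "poly P [:y:] \<noteq> 0" by blast
  have "\<not> UNIV \<subseteq> {x. poly (poly P [:y:]) x = 0}"
    using poly_roots_finite[OF y] finite_subset infinite_UNIV_char_0[where 'a = complex] by blast
  then show thesis using that by blast
qed

text \<open>
  Polynomials over an integral domain form an integral domain, so finitely many open conditions on the
  parameters can be met together once each of them can be met separately.
\<close>

lemma common_bivariate_nonroot:
  fixes P Q R :: "complex poly poly"
  assumes "poly (poly P [:y1:]) x1 \<noteq> 0" "poly (poly Q [:y2:]) x2 \<noteq> 0" "poly (poly R [:y3:]) x3 \<noteq> 0"
  obtains x y where "poly (poly P [:y:]) x \<noteq> 0" "poly (poly Q [:y:]) x \<noteq> 0" "poly (poly R [:y:]) x \<noteq> 0"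
proof -
  have "P * Q * R \<noteq> 0" using assms by auto
  then obtain x y where "poly (poly (P * Q * R) [:y:]) x \<noteq> 0" by (rule bivariate_nonroot)
  then show thesis by (intro that[where x = x and y = y]) auto
qed

text \<open>
  With the first row of the matrix equal to \<open>(- r2 * b - r3 * c, r2, r3)\<close> and the second one to
  \<open>(m - g2 * b - g3 * c, g2, g3)\<close>, multiply on the right by
  \<open>X = [[1, d, e], [b, f, d], [c, b, 1]]\<close> with \<open>f = 1 + b * d - c * e\<close>. This polynomial, in the inner
  variable \<open>d\<close> and the outer variable \<open>e\<close>, is the expression \<open>m * k13 - k22 * k12\<close> in the
  entries of the product that lemma \<open>three_toeplitz_if_first_column_e2\<close> requires to be nonzero. Putting the third row in place
  of the first yields \<open>m * k33 - k22 * k32\<close>.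
\<close>

definition obstruction :: "complex \<Rightarrow> complex \<Rightarrow> complex \<Rightarrow> complex \<Rightarrow> complex \<Rightarrow> complex \<Rightarrow> complex \<Rightarrow> complex poly poly" where
  "obstruction m b c g2 g3 r2 r3 =
    (let D = [:[:0, 1:]:]; E = [:0, 1:]; C = (\<lambda>z. [:[:z:]:]) in
     C m * (C r2 * (D - C b * E) + C r3 * (1 - C c * E)) -
     (C (m - g3 * c) * D + C g2 * (1 - C c * E) + C (g3 * b)) * (C r2 * (1 - C c * E) + C r3 * (C b - C c * D)))"

lemma poly_obstruction:
  "poly (poly (obstruction m b c g2 g3 r2 r3) [:e:]) d =
     m * (r2 * (d - b * e) + r3 * (1 - c * e)) -
     ((m - g3 * c) * d + g2 * (1 - c * e) + g3 * b) * (r2 * (1 - c * e) + r3 * (b - c * d))"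
  by (simp add: obstruction_def Let_def algebra_simps)

text \<open>
  If the values \<open>F d e\<close> were all zero, so would be the coefficients of \<open>F\<close>, each of which is a
  combination of a few values. For \<open>c = 0\<close> the linear coefficients \<open>- m * r3 * b\<close> and \<open>- m * r2 * b\<close>
  suffice. For \<open>c \<noteq> 0\<close> the quadratic coefficients force \<open>g2 = 0\<close> and \<open>m = g3 * c\<close>, and then
  the linear ones force \<open>r2 = r3 = 0\<close>.
\<close>

lemma obstruction_nonroot:
  assumes m: "m \<noteq> 0" and bc: "b \<noteq> 0 \<or> c \<noteq> 0" and r: "r2 \<noteq> 0 \<or> r3 \<noteq> 0"
  obtains d e where "poly (poly (obstruction m b c g2 g3 r2 r3) [:e:]) d \<noteq> 0"
proof (rule ccontr)
  define F where "F d e = m * (r2 * (d - b * e) + r3 * (1 - c * e)) -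
     ((m - g3 * c) * d + g2 * (1 - c * e) + g3 * b) * (r2 * (1 - c * e) + r3 * (b - c * d))" for d e
  assume "\<not> thesis"
  then have F: "F d e = 0" for d e
    using that by (force simp: poly_obstruction F_def)
  have "2 * (m * r2 - (m - g3 * c) * (r2 + r3 * b) + (g2 + g3 * b) * (r3 * c)) = F 1 0 - F (-1) 0"
    unfolding F_def by (simp add: algebra_simps)
  then have d1: "m * r2 - (m - g3 * c) * (r2 + r3 * b) + (g2 + g3 * b) * (r3 * c) = 0"
    unfolding F by (metis diff_self mult_eq_0_iff zero_neq_numeral)
  show False
  proof (cases "c = 0")
    case True
    have "r3 * b = 0" using d1 m by (simp add: True algebra_simps)
    moreover have "r2 * b = 0"
      using F[of 0 1] F[of 0 0] m unfolding F_def by (simp add: True algebra_simps)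
    ultimately show False using bc r True by auto
  next
    case False
    have "2 * (r3 * c * (m - g3 * c)) = F 1 0 + F (-1) 0 - 2 * F 0 0"
      unfolding F_def by (simp add: algebra_simps)
    then have d2: "r3 * (m - g3 * c) = 0" using False F by simp
    have "-2 * (g2 * r2 * c * c) = F 0 1 + F 0 (-1) - 2 * F 0 0"
      unfolding F_def by (simp add: algebra_simps)
    then have e2: "g2 * r2 = 0" using False F by simp
    have "c * (r2 * (m - g3 * c) - g2 * r3 * c) = F 1 1 - F 1 0 - F 0 1 + F 0 0"
      unfolding F_def by (simp add: algebra_simps)
    then have de: "r2 * (m - g3 * c) - g2 * r3 * c = 0" using False F by simp
    have g2: "g2 = 0" using d2 e2 de r False by auto
    have h: "m = g3 * c" using d2 de r unfolding g2 by auto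
    have "F 0 1 - F 0 0 = - (m * r3 * c)" unfolding F_def g2 h by (simp add: algebra_simps)
    then have "r3 = 0" using F m False by simp
    with d1 r m h show False by (simp add: g2)
  qed
qed

text \<open>
  The matrix sends \<open>(1, b, c)\<close> to \<open>m\<close> times \<open>e2\<close>, hence \<open>(1, b, c)\<close> is the first column of \<open>X\<close>.
  The inverse of a Toeplitz matrix is symmetric about the antidiagonal; conversely an invertible one, of
  the shape \<open>[[1, d, e], [b, f, d], [c, b, 1]]\<close>, has a Toeplitz inverse if its first two diagonal
  cofactors \<open>f - b * d\<close> and \<open>1 - c * e\<close> agree, which fixes \<open>f\<close>. The parameters \<open>d\<close>, \<open>e\<close>
  must avoid the zeros of the determinant of \<open>X\<close> and of the two obstructions.
\<close>

lemma four_toeplitz_if_preimage_not_axis: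
  assumes m: "m \<noteq> 0" and bc: "b \<noteq> 0 \<or> c \<noteq> 0" and r: "r2 \<noteq> 0 \<or> r3 \<noteq> 0" and s: "s2 \<noteq> 0 \<or> s3 \<noteq> 0"
  shows "toeplitz_product 3 4
    (m3 (- (r2 * b) - r3 * c) r2 r3 (m - g2 * b - g3 * c) g2 g3 (- (s2 * b) - s3 * c) s2 s3)"
    (is "toeplitz_product 3 4 ?M")
proof -
  define det where "det d e = (1 - c * e)^2 + (c * d - b) * (d - b * e)" for d e
  define P where "P = (let D = [:[:0, 1:]:]; E = [:0, 1:]; C = (\<lambda>z. [:[:z:]:]) in
     (1 - C c * E) * (1 - C c * E) + (C c * D - C b) * (D - C b * E) :: complex poly poly)"
  have P: "poly (poly P [:e:]) d = det d e" for d e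
    by (simp add: P_def det_def Let_def algebra_simps power2_eq_square)
  have P0: "poly (poly P [:0:]) 0 \<noteq> 0" unfolding P by (simp add: det_def)
  obtain d1 e1 where 1: "poly (poly (obstruction m b c g2 g3 r2 r3) [:e1:]) d1 \<noteq> 0"
    using obstruction_nonroot[OF m bc r] by blast
  obtain d3 e3 where 3: "poly (poly (obstruction m b c g2 g3 s2 s3) [:e3:]) d3 \<noteq> 0"
    using obstruction_nonroot[OF m bc s] by blast
  obtain d e where det: "det d e \<noteq> 0"
    and F1: "poly (poly (obstruction m b c g2 g3 r2 r3) [:e:]) d \<noteq> 0"
    and F3: "poly (poly (obstruction m b c g2 g3 s2 s3) [:e:]) d \<noteq> 0"
    using common_bivariate_nonroot[OF P0 1 3] unfolding P by blast
  define f where "f = 1 + b * d - c * e"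
  define i where "i = inverse (det d e)"
  have i: "i * ((1 - c * e)^2 + (c * d - b) * (d - b * e)) = 1"
    using det by (simp add: i_def det_def)
  let ?X = "m3 1 d e b f d c b 1"
  let ?B = "toep (i * (b^2 - c * f)) (i * (c * d - b)) (i * (1 - c * e)) (i * (b * e - d)) (i * (d^2 - e * f))"
  have XB: "?X * ?B = 1\<^sub>m 3"
  proof -
    let ?u = "i * ((1 - c * e)^2 + (c * d - b) * (d - b * e))"
    have "?X * ?B = m3 ?u 0 0 0 ?u 0 0 0 ?u"
      unfolding m3_mult m3_eq_iff f_def by (simp add: algebra_simps power2_eq_square)
    then show ?thesis by (simp only: i one_m3)
  qed
  have MX: "?M * ?X = m3 0 (r2 * (1 - c * e) + r3 * (b - c * d)) (r2 * (d - b * e) + r3 * (1 - c * e))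
      m ((m - g3 * c) * d + g2 * (1 - c * e) + g3 * b) ((m - g2 * b - g3 * c) * e + g2 * d + g3)
      0 (s2 * (1 - c * e) + s3 * (b - c * d)) (s2 * (d - b * e) + s3 * (1 - c * e))"
    unfolding m3_mult m3_eq_iff f_def by (simp add: algebra_simps)
  have "toeplitz_product 3 3 (?M * ?X)"
    unfolding MX using m F1 F3
    by (intro three_toeplitz_if_first_column_e2) (simp_all add: poly_obstruction)
  then have "toeplitz_product 3 (3 + 1) (?M * ?X * ?B)"
    by (intro toeplitz_product_mult toeplitz_productI1 toeplitz_mat_toep)
  also have "?M * ?X * ?B = ?M * (?X * ?B)" by (rule assoc_mult_mat[of _ 3 3 _ 3 _ 3]) simp_all
  also have "\<dots> = ?M" unfolding XB by (rule right_mult_one_mat[of _ 3]) simp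
  finally show ?thesis by simp
qed

text \<open>
  Assume that one of the two conditions for a product of three fails. Up to a unipotent upper triangular
  Toeplitz factor on the right and a unipotent triangular Toeplitz factor on the left, and up to the
  scalar \<open>m\<close>, the matrix is then one of two sparse matrices, each of which is a product of two
  Toeplitz matrices by an explicit formula.
\<close>

lemma four_toeplitz_if_first_column_e2:
  assumes m: "m \<noteq> 0" and det: "r2 * s3 \<noteq> r3 * s2"
  shows "toeplitz_product 3 4 (m3 0 r2 r3 m g2 g3 0 s2 s3)" (is "toeplitz_product 3 4 ?M")
proof -
  consider "m * r3 \<noteq> g2 * r2" "m * s3 \<noteq> g2 * s2" | "m * r3 = g2 * r2" | "m * s3 = g2 * s2" by blast
  then show ?thesis
  proof cases
    case 1
    then have "toeplitz_product 3 3 ?M" using m by (intro three_toeplitz_if_first_column_e2)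
    then show ?thesis by (rule toeplitz_product_mono) simp
  next
    case 2
    have r2: "r2 \<noteq> 0"
    proof
      assume "r2 = 0"
      with 2 m have "r3 = 0" by simp
      with \<open>r2 = 0\<close> det show False by simp
    qed
    have g2: "g2 = m * r3 / r2" using 2 r2 by (simp add: field_simps)
    \<comment> \<open>The sparse matrix is \<open>N = [[0, r, 0], [1, 0, r], [0, 0, t]]\<close>. With \<open>X\<close> the lower triangular Toeplitz
      matrix with entries \<open>r\<close>, \<open>t\<close>, \<open>(t^2 - r) / r\<close>, the product \<open>N * X\<close> is Toeplitz; the third factor
      below is the inverse of \<open>X\<close>.\<close>
    define r t where "r = r2 / m" and "t = (s3 - s2 * r3 / r2) / m"
    have r: "r \<noteq> 0" "r2 = m * r" using r2 m by (simp_all add: r_def)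
    have s3: "s3 = m * t + s2 * r3 / r2" using m by (simp add: t_def)
    have "toeplitz_product 3 4 (toep (s2 / r2) 0 1 0 0
      * toep (m * t * (t^2 - r) / r) (m * t^2) (m * r * t) (m * r^2) 0
      * toep (1 / r^2) (- t / r^2) (1 / r) 0 0
      * toep 0 0 1 (r3 / r2) (g3 / m - r))"
      by (intro toeplitz_productI4 toeplitz_mat_toep)
    also have "toep (s2 / r2) 0 1 0 0
      * toep (m * t * (t^2 - r) / r) (m * t^2) (m * r * t) (m * r^2) 0
      * toep (1 / r^2) (- t / r^2) (1 / r) 0 0
      * toep 0 0 1 (r3 / r2) (g3 / m - r) = ?M"
      unfolding m3_mult m3_eq_iff s3 g2 r(2) using r(1) m by (simp add: field_simps power2_eq_square)
    finally show ?thesis .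
  next
    case 3
    have s2: "s2 \<noteq> 0"
    proof
      assume "s2 = 0"
      with 3 m have "s3 = 0" by simp
      with \<open>s2 = 0\<close> det show False by simp
    qed
    have g2: "g2 = m * s3 / s2" using 3 s2 by (simp add: field_simps)
    \<comment> \<open>The sparse matrix is \<open>[[0, 0, v], [1, 0, 0], [0, s2 / m, 0]]\<close>, the product of two weighted cyclic
      permutation matrices.\<close>
    define v where "v = (r3 - r2 * s3 / s2) / m"
    have v: "v \<noteq> 0" using det s2 m by (simp add: v_def field_simps)
    have r3: "r3 = m * v + r2 * s3 / s2" using m by (simp add: v_def)
    have "toeplitz_product 3 4 (toep 0 0 1 0 (r2 / s2) * toep s2 0 0 (m * v) 0
        * toep (1 / v) 0 0 1 0 * toep 0 0 1 (s3 / s2) (g3 / m))"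
      by (intro toeplitz_productI4 toeplitz_mat_toep)
    also have "toep 0 0 1 0 (r2 / s2) * toep s2 0 0 (m * v) 0
        * toep (1 / v) 0 0 1 0 * toep 0 0 1 (s3 / s2) (g3 / m) = ?M"
      unfolding m3_mult m3_eq_iff r3 g2 using v m s2 by (simp add: field_simps)
    finally show ?thesis .
  qed
qed

text \<open>
  Take \<open>X = [[0, 0, 1], [1, f, 0], [0, 1, 0]]\<close>, which moves the second column to the front. The free
  entry \<open>f\<close> gives the middle entry of the product an arbitrary value \<open>y\<close>, and each condition excludes at
  most one value.
\<close>

lemma four_toeplitz_if_second_column_e2:
  assumes m: "m \<noteq> 0" and r: "r1 \<noteq> 0 \<or> r3 \<noteq> 0" and s: "s1 \<noteq> 0 \<or> s3 \<noteq> 0"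
  shows "toeplitz_product 3 4 (m3 r1 0 r3 g1 m g3 s1 0 s3)"
proof -
  obtain y where y: "y \<notin> {m * r1 / r3, m * s1 / s3}"
    using ex_new_if_finite[OF infinite_UNIV_char_0, of "{m * r1 / r3, m * s1 / s3}"] by blast
  have avoid: "m * u1 \<noteq> y * u3" if "u1 \<noteq> 0 \<or> u3 \<noteq> 0" "y \<noteq> m * u1 / u3" for u1 u3
    using that m by (cases "u3 = 0") (auto simp: nonzero_eq_divide_eq)
  have "m * r1 \<noteq> y * r3" "m * s1 \<noteq> y * s3"
    using avoid[OF r] avoid[OF s] y by blast+
  then have "toeplitz_product 3 3 (m3 0 r3 r1 m y g1 0 s3 s1)"
    using m by (intro three_toeplitz_if_first_column_e2)
  then have "toeplitz_product 3 (3 + 1) (m3 0 r3 r1 m y g1 0 s3 s1 * toep 1 0 0 1 ((g3 - y) / m))"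
    by (intro toeplitz_product_mult toeplitz_productI1 toeplitz_mat_toep)
  also have "m3 0 r3 r1 m y g1 0 s3 s1 * toep 1 0 0 1 ((g3 - y) / m) = m3 r1 0 r3 g1 m g3 s1 0 s3"
    unfolding m3_mult m3_eq_iff using m by simp
  finally show ?thesis by simp
qed

text \<open>
  Dividing by \<open>x1\<close> normalizes the preimage to \<open>(1, y, z)\<close> and expresses the first column through the
  other two.
\<close>

lemma four_toeplitz_if_preimage_first_coordinate:
  assumes det: "a * (e * k - f * h) - b * (d * k - f * g) + c * (d * h - e * g) \<noteq> 0"
    and x1: "x1 \<noteq> 0" and m: "m \<noteq> 0"
    and sys: "a * x1 + b * x2 + c * x3 = 0" "d * x1 + e * x2 + f * x3 = m" "g * x1 + h * x2 + k * x3 = 0"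
  shows "toeplitz_product 3 4 (m3 a b c d e f g h k)"
proof -
  define y z n where "y = x2 / x1" and "z = x3 / x1" and "n = m / x1"
  have n: "n \<noteq> 0" using m x1 by (simp add: n_def)
  have "a + b * y + c * z = (a * x1 + b * x2 + c * x3) / x1"
    using x1 by (simp add: y_def z_def field_simps)
  then have a: "a = - (b * y) - c * z" using sys(1) by (simp add: algebra_simps eq_neg_iff_add_eq_0)
  have "d + e * y + f * z = (d * x1 + e * x2 + f * x3) / x1"
    using x1 by (simp add: y_def z_def field_simps)
  then have d: "d = n - e * y - f * z" using sys(2) by (simp add: n_def algebra_simps)
  have "g + h * y + k * z = (g * x1 + h * x2 + k * x3) / x1"
    using x1 by (simp add: y_def z_def field_simps)
  then have g: "g = - (h * y) - k * z" using sys(3) by (simp add: algebra_simps eq_neg_iff_add_eq_0)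
  show ?thesis
  proof (cases "y = 0 \<and> z = 0")
    case True
    then have "b * k \<noteq> c * h" using det by (auto simp: a d g algebra_simps)
    with n have "toeplitz_product 3 4 (m3 0 b c n e f 0 h k)" by (rule four_toeplitz_if_first_column_e2)
    then show ?thesis using True by (simp add: a d g)
  next
    case False
    have "b \<noteq> 0 \<or> c \<noteq> 0" "h \<noteq> 0 \<or> k \<noteq> 0" using det by (auto simp: a g)
    with n False show ?thesis unfolding a d g by (intro four_toeplitz_if_preimage_not_axis) auto
  qed
qed

text \<open>
  The second column of the adjugate matrix serves as the preimage of a multiple of \<open>e2\<close>.
\<close>

lemma four_toeplitz_nonsingular:
  assumes det: "a * (e * k - f * h) - b * (d * k - f * g) + c * (d * h - e * g) \<noteq> 0"
  shows "toeplitz_product 3 4 (m3 a b c d e f g h k)"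
proof -
  define x1 x2 x3 where "x1 = c * h - b * k" and "x2 = a * k - c * g" and "x3 = b * g - a * h"
  define m where "m = d * x1 + e * x2 + f * x3"
  have m: "m \<noteq> 0" using det by (simp add: m_def x1_def x2_def x3_def algebra_simps)
  have sys: "a * x1 + b * x2 + c * x3 = 0" "d * x1 + e * x2 + f * x3 = m" "g * x1 + h * x2 + k * x3 = 0"
    by (simp_all add: m_def x1_def x2_def x3_def algebra_simps)
  consider "x1 \<noteq> 0" | "x3 \<noteq> 0" | "x1 = 0" "x3 = 0" by blast
  then show ?thesis
  proof cases
    case 1
    show ?thesis by (rule four_toeplitz_if_preimage_first_coordinate[OF det 1 m sys])
  next
    case 2
    have "toeplitz_product 3 4 (m3 k h g f e d c b a)"
      by (rule four_toeplitz_if_preimage_first_coordinate[OF _ 2 m, where ?x2.0 = x2 and ?x3.0 = x1])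
        (use det sys in \<open>simp_all add: algebra_simps\<close>)
    then show ?thesis by (rule toeplitz_product_reverse)
  next
    case 3
    then have x2: "x2 \<noteq> 0" using m by (auto simp: m_def)
    then have "b = 0" "h = 0" "e \<noteq> 0" using sys m 3 by auto
    moreover have "a \<noteq> 0 \<or> c \<noteq> 0" "g \<noteq> 0 \<or> k \<noteq> 0" using x2 by (auto simp: x2_def)
    ultimately show ?thesis by (simp add: four_toeplitz_if_second_column_e2)
  qed
qed

lemma four_toeplitz:
  assumes "M \<in> carrier_mat 3 3"
  shows "toeplitz_product 3 4 M"
proof -
  obtain a b c d e f g h k where M: "M = m3 a b c d e f g h k"
    using assms by (rule m3_cases)
  show ?thesis
  proof (cases "a * (e * k - f * h) - b * (d * k - f * g) + c * (d * h - e * g) = 0")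
    case True
    then show ?thesis unfolding M by (rule left_kernel_of_singular) (rule four_toeplitz_singular)
  next
    case False
    then show ?thesis unfolding M by (rule four_toeplitz_nonsingular)
  qed
qed

section \<open>The maximal Toeplitz number of order three\<close>

theorem theorem4p6:
  shows "3 \<le> max_toeplitz_number 3 \<and> max_toeplitz_number 3 \<le> 4"
proof
  let ?D = "m3 1 0 0 0 2 0 0 0 3"
  have "3 \<le> toeplitz_number 3 ?D"
    unfolding toeplitz_number_def
  proof (rule Inf_greatest)
    fix x assume "x \<in> {enat s |s. 1 \<le> s \<and> toeplitz_product 3 s ?D}"
    then obtain s where s: "x = enat s" "toeplitz_product 3 s ?D" by blast
    have "\<not> s \<le> 2" using toeplitz_product_mono[OF s(2)] diag_123_not_two_toeplitz by blast
    then show "3 \<le> x" using s(1) by (simp add: numeral_eq_enat)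
  qed
  also have "toeplitz_number 3 ?D \<le> max_toeplitz_number 3"
    unfolding max_toeplitz_number_def by (rule SUP_upper) simp
  finally show "3 \<le> max_toeplitz_number 3" .
  show "max_toeplitz_number 3 \<le> 4"
    unfolding max_toeplitz_number_def toeplitz_number_def
  proof (rule SUP_least, rule Inf_lower)
    fix M :: "complex mat" assume "M \<in> carrier_mat 3 3"
    then have "toeplitz_product 3 4 M" by (rule four_toeplitz)
    moreover have "(4::enat) = enat 4" by (simp add: numeral_eq_enat)
    ultimately show "4 \<in> {enat s |s. 1 \<le> s \<and> toeplitz_product 3 s M}"
      by (auto intro!: exI[of _ 4])
  qed
qed

end
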